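(* Let $(X,Y)$ be a random vector with marginal distributions $F,G$ and let $\Theta$ be a non-negative random variable with distribution $B$ such that $B(0)<1$. Suppose that $\Theta$ and $(X,Y)$ are independent, that for every $c>0$ $$\mathbf{P}[\Theta>c\,(x\wedge y)]=o\big(\mathbf{P}[\Theta X>x,\ \Theta Y>y]\big),\qquad x\wedge y\to\infty,$$ and that $(X,Y)\in\mathcal{L}^{(2)}$. Then $(\Theta X,\Theta Y)\in\mathcal{L}^{(2)}$.
   Context: $x\wedge y=\min\{x,y\}$; $f(x,y)=o(g(x,y))$ as $x\wedge y\to\infty$ means $\lim_{x\wedge y\to\infty}f(x,y)/g(x,y)=0$. For a distribution $F$, $\overline F=1-F$; $F$ and $G$ satisfy $\overline F(x)>0$, $\overline G(x)>0$ for all $x\ge0$. $F\in\mathcal{L}$ (long-tailed) if $\lim_{x\to\infty}\overline F(x-a)/\overline F(x)=1$ for every $a>0$. A random pair $(X,Y)$ with marginal distributions $F,G$ belongs to $\mathcal{L}^{(2)}$ if $F\in\mathcal{L}$, $G\in\mathcal{L}$ and $\lim_{x\wedge y\to\infty}\mathbf{P}[X>x-a_1,Y>y-a_2]/\mathbf{P}[X>x,Y>y]=1$ for every $(a_1,a_2)\in[0,\infty)^2\setminus\{(0,0)\}$ (joint tails in denominators are implicitly positive). The distribution $B$ is allowed to have support bounded from above. *)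

theory Defs
  imports "HOL-Probability.Probability"
begin

text \<open>The mode of convergence \<open>x \<and> y \<rightarrow> \<infinity>\<close>, where \<open>x \<and> y = min x y\<close>.\<close>

definition min_at_top :: "(real \<times> real) filter"
  where "min_at_top = filtercomap (\<lambda>(x, y). min x y) at_top"

text \<open>The class of long-tailed distributions, for a distribution function \<open>F\<close>. The standing
  assumption that tails are positive on \<open>[0, \<infinity>)\<close> is made part of the class.\<close>

definition long_tailed :: "(real \<Rightarrow> real) \<Rightarrow> bool"
  where "long_tailed F \<longleftrightarrow>
    (\<forall>x\<ge>0. 1 - F x > 0) \<and>
    (\<forall>a>0. ((\<lambda>x. (1 - F (x - a)) / (1 - F x)) \<longlongrightarrow> 1) at_top)"

definition joint_tail :: "'a measure \<Rightarrow> ('a \<Rightarrow> real) \<Rightarrow> ('a \<Rightarrow> real) \<Rightarrow> real \<Rightarrow> real \<Rightarrow> real"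
  where "joint_tail M X Y x y = \<P>(\<omega> in M. X \<omega> > x \<and> Y \<omega> > y)"

text \<open>Independence of random variables with values in possibly different types: the generated
  sigma-algebras are independent. The constant \<open>prob_space.indep_var\<close> requires both variables to
  have the same value type, so it does not cover a real variable and a random vector.\<close>

definition indep_rvs ::
  "'a measure \<Rightarrow> 'b measure \<Rightarrow> ('a \<Rightarrow> 'b) \<Rightarrow> 'c measure \<Rightarrow> ('a \<Rightarrow> 'c) \<Rightarrow> bool"
  where "indep_rvs M S U T V \<longleftrightarrow>
    prob_space.indep_set M
      (sets (vimage_algebra (space M) U S)) (sets (vimage_algebra (space M) V T))"

text \<open>The bivariate class; positivity of the joint tails, which appear as denominators, is
  stated explicitly.\<close>

definition long_tailed2 :: "'a measure \<Rightarrow> ('a \<Rightarrow> real) \<Rightarrow> ('a \<Rightarrow> real) \<Rightarrow> bool"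
  where "long_tailed2 M X Y \<longleftrightarrow>
    long_tailed (cdf (distr M borel X)) \<and>
    long_tailed (cdf (distr M borel Y)) \<and>
    (\<forall>x\<ge>0. \<forall>y\<ge>0. joint_tail M X Y x y > 0) \<and>
    (\<forall>(a1, a2) \<in> ({0..} \<times> {0..}) - {(0, 0)}.
      ((\<lambda>(x, y). joint_tail M X Y (x - a1) (y - a2) / joint_tail M X Y x y) \<longlongrightarrow> 1) min_at_top)"

end

theory Submission
  imports Defs
begin

text \<open>
  Write \<open>H(x, y) = P(\<Theta>X > x, \<Theta>Y > y)\<close>. A shift of \<open>(x, y)\<close> by \<open>(a1, a2)\<close> acts on the event
  \<open>{\<Theta> = t}\<close> as a shift of \<open>(x/t, y/t)\<close> by \<open>(a1/t, a2/t)\<close>. Long-tailedness of \<open>(X, Y)\<close> controls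
  this as long as the shift stays bounded, that is, \<open>t\<close> stays away from \<open>0\<close>, and the point
  \<open>(x/t, y/t)\<close> stays far out, that is, \<open>t\<close> is at most a small multiple of \<open>min x y\<close>. So, given
  \<open>\<epsilon>\<close>, split the event whose probability is \<open>H(x - a1, y - a2)\<close> according to \<open>\<Theta>\<close>:

  \<^item> On \<open>\<delta> < \<Theta> \<le> min x y / N\<close> the shifts are at most \<open>(a1/\<delta>, a2/\<delta>)\<close>, and integrating the bound for
    \<open>(X, Y)\<close> over the law of \<open>\<Theta>\<close> gives a contribution of at most \<open>(1 + \<epsilon>) H(x, y)\<close>
    (\<open>moderate_scale_shift_bound\<close>, by way of \<open>indep_rvs_section_bound\<close>).
  \<^item> On \<open>\<Theta> > min x y / N\<close> the hypothesis on the tail of \<open>\<Theta>\<close> gives at most \<open>\<epsilon> H(x, y)\<close>.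
  \<^item> On \<open>0 < \<Theta> \<le> \<delta>\<close> the shifts are unbounded, so the comparison with \<open>H(x, y)\<close> is not made directly.
    Smaller values of \<open>\<Theta>\<close> make the event less likely, hence, if \<open>\<delta>\<close> is chosen with
    \<open>P(0 < \<Theta> \<le> \<delta>) \<le> \<epsilon> P(\<Theta> > \<delta>)\<close>, this part is at most \<open>\<epsilon>\<close> times the part with \<open>\<Theta> > \<delta>\<close>,
    which the other two cases bound (\<open>exists_scale_small_mass_below\<close>, \<open>prob_small_scale_le\<close>,
    \<open>prob_large_scale_ge\<close>).

  Together, \<open>H(x, y) \<le> H(x - a1, y - a2) \<le> (1 + \<epsilon>) (1 + 2\<epsilon>) H(x, y)\<close> far out.

  The marginals need no second argument: the tail of \<open>\<Theta>X\<close> at \<open>x\<close> is the joint tail of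
  \<open>(\<Theta>X, \<Theta>X)\<close> at \<open>(x, x)\<close>. Along the diagonal the tail hypothesis for \<open>(\<Theta>X, \<Theta>Y)\<close> implies the one
  for \<open>(\<Theta>X, \<Theta>X)\<close>, whose joint tail is larger there. Off the diagonal that implication fails,
  because \<open>P(\<Theta>X > max x y)\<close> may be far smaller than \<open>P(\<Theta> > c min x y)\<close>; this is why the key limit
  statement \<open>scaled_tail_shift_ratio_tendsto\<close> is proved along an arbitrary filter below
  \<open>min_at_top\<close>.
\<close>

section \<open>Integrating over an independent variable\<close>

lemma indep_rvs_prob_Times:
  assumes "prob_space M" "U \<in> measurable M S" "V \<in> measurable M T"
    and "indep_rvs M S U T V" "A \<in> sets S" "B \<in> sets T"
  shows "\<P>(\<omega> in M. U \<omega> \<in> A \<and> V \<omega> \<in> B) = \<P>(\<omega> in M. U \<omega> \<in> A) * \<P>(\<omega> in M. V \<omega> \<in> B)"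
proof -
  interpret prob_space M by fact
  have "U -` A \<inter> space M \<in> sets (vimage_algebra (space M) U S)"
    using assms(5) by (rule in_vimage_algebra)
  moreover have "V -` B \<inter> space M \<in> sets (vimage_algebra (space M) V T)"
    using assms(6) by (rule in_vimage_algebra)
  ultimately have "prob ((U -` A \<inter> space M) \<inter> (V -` B \<inter> space M)) =
      prob (U -` A \<inter> space M) * prob (V -` B \<inter> space M)"
    using assms(4) unfolding indep_rvs_def by (intro indep_setD)
  moreover have "(U -` A \<inter> space M) \<inter> (V -` B \<inter> space M) = {\<omega> \<in> space M. U \<omega> \<in> A \<and> V \<omega> \<in> B}"
    by auto
  ultimately show ?thesis by (simp add: vimage_def Int_def conj_commute)
qed

text \<open>Used to replace \<open>(X, Y)\<close> by \<open>(X, X)\<close> or \<open>(Y, Y)\<close>.\<close>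

lemma indep_rvs_compose:
  assumes "prob_space M" "V \<in> measurable M T" "indep_rvs M S U T V" "g \<in> measurable T T'"
  shows "indep_rvs M S U T' (\<lambda>\<omega>. g (V \<omega>))"
proof -
  interpret prob_space M by fact
  have "sets (vimage_algebra (space M) (\<lambda>\<omega>. g (V \<omega>)) T') \<subseteq> sets (vimage_algebra (space M) V T)"
  proof -
    have "V \<in> measurable (vimage_algebra (space M) V T) T"
      using measurable_space[OF assms(2)] by (intro measurable_vimage_algebra1) auto
    then have "(\<lambda>\<omega>. g (V \<omega>)) \<in> measurable (vimage_algebra (space M) V T) T'"
      using assms(4) by (rule measurable_compose)
    then have "(\<lambda>\<omega>. g (V \<omega>)) -` A \<inter> space M \<in> sets (vimage_algebra (space M) V T)" if "A \<in> sets T'" for A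
      using that by (auto dest: measurable_sets)
    moreover have "(\<lambda>\<omega>. g (V \<omega>)) \<in> space M \<rightarrow> space T'"
      using measurable_space[OF measurable_compose[OF assms(2,4)]] by auto
    ultimately show ?thesis by (auto simp: sets_vimage_algebra2)
  qed
  then show ?thesis
    using assms(3) unfolding indep_rvs_def indep_set_def
    by (elim indep_sets_mono_sets) (auto split: bool.split)
qed

lemma indep_rvs_distr_pair:
  assumes "prob_space M" and [measurable]: "U \<in> measurable M S" "V \<in> measurable M T"
    and "indep_rvs M S U T V"
  shows "distr M (S \<Otimes>\<^sub>M T) (\<lambda>\<omega>. (U \<omega>, V \<omega>)) = distr M S U \<Otimes>\<^sub>M distr M T V"
proof -
  interpret prob_space M by fact
  interpret DU: prob_space "distr M S U" by (rule prob_space_distr) fact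
  interpret DV: prob_space "distr M T V" by (rule prob_space_distr) fact
  show ?thesis
  proof (rule pair_measure_eqI[symmetric])
    fix A B assume "A \<in> sets (distr M S U)" "B \<in> sets (distr M T V)"
    then have [measurable]: "A \<in> sets S" "B \<in> sets T" by auto
    have "(\<lambda>\<omega>. (U \<omega>, V \<omega>)) -` (A \<times> B) \<inter> space M = {\<omega> \<in> space M. U \<omega> \<in> A \<and> V \<omega> \<in> B}"
      "U -` A \<inter> space M = {\<omega> \<in> space M. U \<omega> \<in> A}" "V -` B \<inter> space M = {\<omega> \<in> space M. V \<omega> \<in> B}"
      by auto
    then show "emeasure (distr M S U) A * emeasure (distr M T V) B =
        emeasure (distr M (S \<Otimes>\<^sub>M T) (\<lambda>\<omega>. (U \<omega>, V \<omega>))) (A \<times> B)"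
      using indep_rvs_prob_Times[OF assms, of A B]
      by (simp add: emeasure_distr emeasure_eq_measure ennreal_mult'')
  qed (auto intro: DU.sigma_finite_measure DV.sigma_finite_measure)
qed

text \<open>By independence the joint law is a product, so both probabilities are integrals over the law
  of \<open>U\<close> of the probabilities of sections; an inequality between all sections integrates. In this
  form the estimates for scaled pairs involve probabilities only.\<close>

lemma indep_rvs_section_bound:
  assumes "prob_space M" and [measurable]: "U \<in> measurable M S" "V \<in> measurable M T"
    and "indep_rvs M S U T V"
    and [measurable]: "A \<in> sets (S \<Otimes>\<^sub>M T)" "B \<in> sets (S \<Otimes>\<^sub>M T)" and "k \<ge> 0"
    and le: "\<And>t. t \<in> space S \<Longrightarrow>
      \<P>(\<omega> in M. (t, V \<omega>) \<in> A) \<le> k * \<P>(\<omega> in M. (t, V \<omega>) \<in> B)"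
  shows "\<P>(\<omega> in M. (U \<omega>, V \<omega>) \<in> A) \<le> k * \<P>(\<omega> in M. (U \<omega>, V \<omega>) \<in> B)"
proof -
  interpret prob_space M by fact
  interpret DU: prob_space "distr M S U" by (rule prob_space_distr) fact
  interpret DV: prob_space "distr M T V" by (rule prob_space_distr) fact
  have disint: "emeasure M {\<omega> \<in> space M. (U \<omega>, V \<omega>) \<in> C} =
      (\<integral>\<^sup>+t. emeasure M {\<omega> \<in> space M. (t, V \<omega>) \<in> C} \<partial>distr M S U)"
    if [measurable]: "C \<in> sets (S \<Otimes>\<^sub>M T)" for C
  proof -
    have "emeasure M {\<omega> \<in> space M. (U \<omega>, V \<omega>) \<in> C} =
        emeasure (distr M (S \<Otimes>\<^sub>M T) (\<lambda>\<omega>. (U \<omega>, V \<omega>))) C"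
      by (subst emeasure_distr) (auto intro!: arg_cong[where f = "emeasure M"])
    also have "\<dots> = (\<integral>\<^sup>+t. emeasure (distr M T V) (Pair t -` C) \<partial>distr M S U)"
      unfolding indep_rvs_distr_pair[OF assms(1-4)]
      by (rule DV.emeasure_pair_measure_alt) simp
    also have "\<dots> = (\<integral>\<^sup>+t. emeasure M {\<omega> \<in> space M. (t, V \<omega>) \<in> C} \<partial>distr M S U)"
      by (intro nn_integral_cong, subst emeasure_distr)
        (auto intro!: arg_cong[where f = "emeasure M"] sets_Pair1)
    finally show ?thesis .
  qed
  have meas: "(\<lambda>t. emeasure M {\<omega> \<in> space M. (t, V \<omega>) \<in> B}) \<in> borel_measurable (distr M S U)"
    by measurable
  have "emeasure M {\<omega> \<in> space M. (U \<omega>, V \<omega>) \<in> A}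
      \<le> (\<integral>\<^sup>+t. ennreal k * emeasure M {\<omega> \<in> space M. (t, V \<omega>) \<in> B} \<partial>distr M S U)"
    unfolding disint[OF assms(5)]
    using le \<open>k \<ge> 0\<close>
    by (intro nn_integral_mono) (simp add: emeasure_eq_measure ennreal_mult''[symmetric] ennreal_leI)
  also have "\<dots> = ennreal k * emeasure M {\<omega> \<in> space M. (U \<omega>, V \<omega>) \<in> B}"
    unfolding disint[OF assms(6)] by (rule nn_integral_cmult[OF meas])
  finally show ?thesis
    using \<open>k \<ge> 0\<close> by (simp add: emeasure_eq_measure ennreal_mult''[symmetric] ennreal_le_iff)
qed

section \<open>Tails and the filter of pairs with large minimum\<close>

lemma eventually_min_at_top:
  "eventually P min_at_top \<longleftrightarrow> (\<exists>N. \<forall>x\<ge>N. \<forall>y\<ge>N. P (x, y))"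
  by (simp add: min_at_top_def eventually_filtercomap_at_top_linorder) blast

lemma filtermap_diagonal_le_min_at_top: "filtermap (\<lambda>x. (x, x)) at_top \<le> min_at_top"
  by (auto simp: le_filter_def eventually_filtermap eventually_min_at_top eventually_at_top_linorder)

lemma (in prob_space) joint_tail_antimono:
  assumes [measurable]: "X \<in> borel_measurable M" "Y \<in> borel_measurable M"
    and "x' \<le> x" "y' \<le> y"
  shows "joint_tail M X Y x y \<le> joint_tail M X Y x' y'"
  unfolding joint_tail_def using assms(3,4) by (intro finite_measure_mono) auto

lemma (in prob_space) one_minus_cdf_eq_joint_tail:
  assumes [measurable]: "X \<in> borel_measurable M"
  shows "1 - cdf (distr M borel X) x = joint_tail M X X x x"
proof -
  have "cdf (distr M borel X) x = prob {\<omega> \<in> space M. X \<omega> \<le> x}"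
    by (auto simp: cdf_def measure_distr intro!: arg_cong[where f = prob])
  moreover have "prob {\<omega> \<in> space M. \<not> X \<omega> \<le> x} = 1 - prob {\<omega> \<in> space M. X \<omega> \<le> x}"
    by (rule prob_neg) measurable
  ultimately show ?thesis by (simp add: joint_tail_def not_le)
qed

text \<open>As \<open>\<delta>\<close> decreases to \<open>0\<close>, right-continuity of the distribution function \<open>B\<close> sends the mass
  \<open>B \<delta> - B 0\<close> of the left-open interval to \<open>0\<close>, while \<open>1 - B \<delta>\<close> tends to \<open>1 - B 0 > 0\<close>.
  An atom of \<open>\<Theta>\<close> at \<open>0\<close> is harmless precisely because the interval is open there.\<close>

lemma (in prob_space) exists_scale_small_mass_below:
  assumes [measurable]: "\<Theta> \<in> borel_measurable M"
    and pos: "cdf (distr M borel \<Theta>) 0 < 1" and "\<epsilon> > 0"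
  shows "\<exists>\<delta>>0. \<P>(\<omega> in M. 0 < \<Theta> \<omega> \<and> \<Theta> \<omega> \<le> \<delta>) \<le> \<epsilon> * \<P>(\<omega> in M. \<Theta> \<omega> > \<delta>)
    \<and> \<P>(\<omega> in M. \<Theta> \<omega> > \<delta>) > 0"
proof -
  interpret D: real_distribution "distr M borel \<Theta>" by (rule real_distribution_distr) fact
  let ?B = "cdf (distr M borel \<Theta>)"
  have lim: "(?B \<longlongrightarrow> ?B 0) (at_right 0)"
    using D.cdf_is_right_cont[of 0] by (simp add: continuous_within)
  have "((\<lambda>\<delta>. (?B \<delta> - ?B 0) - \<epsilon> * (1 - ?B \<delta>)) \<longlongrightarrow> (?B 0 - ?B 0) - \<epsilon> * (1 - ?B 0)) (at_right 0)"
    by (intro tendsto_intros lim)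
  moreover have "(?B 0 - ?B 0) - \<epsilon> * (1 - ?B 0) < 0" using pos \<open>\<epsilon> > 0\<close> by simp
  ultimately have "\<forall>\<^sub>F \<delta> in at_right 0. (?B \<delta> - ?B 0) - \<epsilon> * (1 - ?B \<delta>) < 0"
    by (rule order_tendstoD)
  moreover have "\<forall>\<^sub>F \<delta> in at_right 0. ?B \<delta> < 1" using lim pos by (rule order_tendstoD)
  moreover have "\<forall>\<^sub>F \<delta> in at_right (0::real). \<delta> > 0" by (rule eventually_at_right_less)
  ultimately have "\<forall>\<^sub>F \<delta> in at_right (0::real). \<delta> > 0 \<and> ?B \<delta> - ?B 0 \<le> \<epsilon> * (1 - ?B \<delta>) \<and> ?B \<delta> < 1"
    by eventually_elim auto
  then obtain \<delta> where \<delta>: "\<delta> > 0" "?B \<delta> - ?B 0 \<le> \<epsilon> * (1 - ?B \<delta>)" "?B \<delta> < 1"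
    using eventually_happens'[OF trivial_limit_at_right_real] by blast
  have "\<P>(\<omega> in M. 0 < \<Theta> \<omega> \<and> \<Theta> \<omega> \<le> \<delta>) = ?B \<delta> - ?B 0"
    using D.cdf_diff_eq[OF \<delta>(1)]
    by (auto simp: measure_distr intro!: arg_cong[where f = prob])
  moreover have "\<P>(\<omega> in M. \<Theta> \<omega> > \<delta>) = 1 - ?B \<delta>"
    using one_minus_cdf_eq_joint_tail[of \<Theta> \<delta>] by (simp add: joint_tail_def)
  ultimately show ?thesis using \<delta> by (intro exI[of _ \<delta>]) simp
qed

section \<open>Scaling a random pair by an independent factor\<close>

text \<open>A locale, because the results are needed for \<open>(X, Y)\<close> itself and for the degenerate pairs
  \<open>(X, X)\<close> and \<open>(Y, Y)\<close>.\<close>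

locale independent_scaling = prob_space M
  for M :: "'a measure" +
  fixes \<Theta> X Y :: "'a \<Rightarrow> real"
  assumes measurable_\<Theta> [measurable]: "\<Theta> \<in> borel_measurable M"
    and measurable_X [measurable]: "X \<in> borel_measurable M"
    and measurable_Y [measurable]: "Y \<in> borel_measurable M"
    and nonneg: "AE \<omega> in M. \<Theta> \<omega> \<ge> 0"
    and not_zero: "cdf (distr M borel \<Theta>) 0 < 1"
    and indep: "indep_rvs M borel \<Theta> borel (\<lambda>\<omega>. (X \<omega>, Y \<omega>))"
begin

abbreviation scaled_tail :: "real \<Rightarrow> real \<Rightarrow> real"
  where "scaled_tail \<equiv> joint_tail M (\<lambda>\<omega>. \<Theta> \<omega> * X \<omega>) (\<lambda>\<omega>. \<Theta> \<omega> * Y \<omega>)"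

lemma prob_scale_times_joint_tail:
  assumes [measurable]: "A \<in> sets borel"
  shows "\<P>(\<omega> in M. \<Theta> \<omega> \<in> A) * joint_tail M X Y x y =
    \<P>(\<omega> in M. \<Theta> \<omega> \<in> A \<and> X \<omega> > x \<and> Y \<omega> > y)"
proof -
  have "{x<..} \<times> {y<..} \<in> sets (borel :: (real \<times> real) measure)"
    by (intro borel_open open_Times) auto
  with indep_rvs_prob_Times[OF prob_space_axioms measurable_\<Theta> _ indep assms this]
  show ?thesis by (simp add: joint_tail_def)
qed

text \<open>For nonnegative thresholds, enlarging the scale enlarges the event \<open>{tX > x, tY > y}\<close>: with
  scales above \<open>\<delta>\<close> it contains, and with scales up to \<open>\<delta>\<close> it is contained in, the event for the
  scale \<open>\<delta>\<close> itself, which is independent of \<open>\<Theta>\<close>. The next two bounds express this.\<close>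

lemma prob_large_scale_ge:
  assumes "\<delta> > 0" "x \<ge> 0" "y \<ge> 0"
  shows "\<P>(\<omega> in M. \<Theta> \<omega> > \<delta>) * joint_tail M X Y (x / \<delta>) (y / \<delta>)
    \<le> \<P>(\<omega> in M. \<Theta> \<omega> > \<delta> \<and> \<Theta> \<omega> * X \<omega> > x \<and> \<Theta> \<omega> * Y \<omega> > y)"
proof -
  have scale: "t * u > z" if "t > \<delta>" "u > z / \<delta>" "z \<ge> 0" for t u z :: real
  proof -
    have "u > 0" using that assms(1) by (smt (verit) divide_nonneg_pos)
    have "z < \<delta> * u" using that assms(1) by (simp add: field_simps)
    also have "\<dots> \<le> t * u" using that \<open>u > 0\<close> by (intro mult_right_mono) auto
    finally show ?thesis .
  qed
  show ?thesis
    using prob_scale_times_joint_tail[of "{\<delta><..}" "x / \<delta>" "y / \<delta>"] scale assms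
    by (auto intro!: finite_measure_mono)
qed

lemma prob_small_scale_le:
  assumes "\<delta> > 0" "x \<ge> 0" "y \<ge> 0"
  shows "\<P>(\<omega> in M. (0 < \<Theta> \<omega> \<and> \<Theta> \<omega> \<le> \<delta>) \<and> \<Theta> \<omega> * X \<omega> > x \<and> \<Theta> \<omega> * Y \<omega> > y)
    \<le> \<P>(\<omega> in M. 0 < \<Theta> \<omega> \<and> \<Theta> \<omega> \<le> \<delta>) * joint_tail M X Y (x / \<delta>) (y / \<delta>)"
proof -
  have scale: "u > z / \<delta>" if "0 < t" "t \<le> \<delta>" "t * u > z" "z \<ge> 0" for t u z :: real
  proof -
    have "u > 0" using that by (smt (verit) mult_nonneg_nonpos)
    have "z < t * u" by fact
    also have "\<dots> \<le> \<delta> * u" using that \<open>u > 0\<close> by (intro mult_right_mono) auto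
    finally show ?thesis using assms(1) by (simp add: field_simps)
  qed
  show ?thesis
    using prob_scale_times_joint_tail[of "{0<..\<delta>}" "x / \<delta>" "y / \<delta>"] scale assms
    by (auto intro!: finite_measure_mono)
qed

lemma scaled_tail_pos:
  assumes pos: "\<And>x y. x \<ge> 0 \<Longrightarrow> y \<ge> 0 \<Longrightarrow> joint_tail M X Y x y > 0"
    and "x \<ge> 0" "y \<ge> 0"
  shows "scaled_tail x y > 0"
proof -
  obtain \<delta> where \<delta>: "\<delta> > 0" "\<P>(\<omega> in M. \<Theta> \<omega> > \<delta>) > 0"
    using exists_scale_small_mass_below[OF measurable_\<Theta> not_zero zero_less_one] by auto
  have "0 < \<P>(\<omega> in M. \<Theta> \<omega> > \<delta>) * joint_tail M X Y (x / \<delta>) (y / \<delta>)"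
    using \<delta> assms by (intro mult_pos_pos pos) auto
  also have "\<dots> \<le> \<P>(\<omega> in M. \<Theta> \<omega> > \<delta> \<and> \<Theta> \<omega> * X \<omega> > x \<and> \<Theta> \<omega> * Y \<omega> > y)"
    using \<delta> assms by (intro prob_large_scale_ge)
  also have "\<dots> \<le> scaled_tail x y"
    unfolding joint_tail_def by (intro finite_measure_mono) auto
  finally show ?thesis .
qed

text \<open>For a fixed scale \<open>t\<close> in the range \<open>\<delta> < t \<le> min x y / N\<close> the point \<open>(x/t, y/t)\<close> has both
  coordinates at least \<open>N\<close>, and the shift \<open>(a1/t, a2/t)\<close> is dominated by \<open>(a1/\<delta>, a2/\<delta>)\<close>, so
  the bound for the unscaled pair applies with one and the same shift for all \<open>t\<close>.\<close>

lemma moderate_scale_shift_bound: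
  assumes "\<delta> > 0" "N > 0" "k \<ge> 0" "a1 \<ge> 0" "a2 \<ge> 0"
    and base: "\<And>u v. u \<ge> N \<Longrightarrow> v \<ge> N \<Longrightarrow>
      joint_tail M X Y (u - a1 / \<delta>) (v - a2 / \<delta>) \<le> k * joint_tail M X Y u v"
  shows "\<P>(\<omega> in M. (\<delta> < \<Theta> \<omega> \<and> \<Theta> \<omega> \<le> min x y / N) \<and> \<Theta> \<omega> * X \<omega> > x - a1 \<and> \<Theta> \<omega> * Y \<omega> > y - a2)
    \<le> k * scaled_tail x y"
proof -
  have [measurable]: "fst \<in> borel_measurable (borel :: (real \<times> real) measure)"
    "snd \<in> borel_measurable (borel :: (real \<times> real) measure)"
    by (intro borel_measurable_continuous_onI continuous_intros)+
  let ?E = "\<lambda>p q. {z \<in> space (borel \<Otimes>\<^sub>M borel :: (real \<times> real \<times> real) measure).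
    (\<delta> < fst z \<and> fst z \<le> min x y / N) \<and> fst z * fst (snd z) > p \<and> fst z * snd (snd z) > q}"
  have sets: "?E p q \<in> sets (borel \<Otimes>\<^sub>M borel)" for p q
    by measurable
  have "\<P>(\<omega> in M. (\<Theta> \<omega>, X \<omega>, Y \<omega>) \<in> ?E (x - a1) (y - a2))
      \<le> k * \<P>(\<omega> in M. (\<Theta> \<omega>, X \<omega>, Y \<omega>) \<in> ?E x y)"
  proof (rule indep_rvs_section_bound[OF prob_space_axioms measurable_\<Theta> _ indep sets sets \<open>k \<ge> 0\<close>])
    fix t :: real
    show "\<P>(\<omega> in M. (t, X \<omega>, Y \<omega>) \<in> ?E (x - a1) (y - a2))
        \<le> k * \<P>(\<omega> in M. (t, X \<omega>, Y \<omega>) \<in> ?E x y)"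
    proof (cases "\<delta> < t \<and> t \<le> min x y / N")
      case True
      then have t: "t > 0" "x / t \<ge> N" "y / t \<ge> N" "\<delta> \<le> t"
        using assms(1,2) by (auto simp: field_simps)
      have sec: "\<P>(\<omega> in M. (t, X \<omega>, Y \<omega>) \<in> ?E p q) = joint_tail M X Y (p / t) (q / t)" for p q
        using True t(1) by (simp add: joint_tail_def space_pair_measure pos_divide_less_eq mult.commute)
      have shift: "z / t - a / \<delta> \<le> (z - a) / t" if "a \<ge> 0" for z a :: real
        using t assms(1) that by (simp add: diff_divide_distrib frac_le)
      have "joint_tail M X Y ((x - a1) / t) ((y - a2) / t)
          \<le> joint_tail M X Y (x / t - a1 / \<delta>) (y / t - a2 / \<delta>)"
        using assms(4,5) by (intro joint_tail_antimono shift) auto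
      also have "\<dots> \<le> k * joint_tail M X Y (x / t) (y / t)"
        using t by (intro base)
      finally show ?thesis unfolding sec .
    next
      case False
      then have empty: "{\<omega> \<in> space M. (t, X \<omega>, Y \<omega>) \<in> ?E p q} = {}" for p q
        by auto
      show ?thesis unfolding empty by simp
    qed
  qed measurable
  also have "\<dots> \<le> k * scaled_tail x y"
    unfolding joint_tail_def using \<open>k \<ge> 0\<close>
    by (intro mult_left_mono finite_measure_mono) auto
  finally show ?thesis by (simp add: space_pair_measure)
qed

text \<open>The order of choices matters: \<open>\<delta>\<close> depends on the law of \<open>\<Theta>\<close> and on \<open>\<epsilon>\<close> only; it fixes the
  shift \<open>(a1/\<delta>, a2/\<delta>)\<close>, which determines \<open>N\<close>; and \<open>N\<close> fixes the constant \<open>c = 1/N\<close> at which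
  the tail hypothesis on \<open>\<Theta>\<close> is used.\<close>

lemma eventually_scaled_tail_shift_le:
  assumes pos: "\<And>x y. x \<ge> 0 \<Longrightarrow> y \<ge> 0 \<Longrightarrow> joint_tail M X Y x y > 0"
    and base: "\<And>b1 b2. b1 \<ge> 0 \<Longrightarrow> b2 \<ge> 0 \<Longrightarrow> (b1, b2) \<noteq> (0, 0) \<Longrightarrow>
      ((\<lambda>(x, y). joint_tail M X Y (x - b1) (y - b2) / joint_tail M X Y x y) \<longlongrightarrow> 1) min_at_top"
    and F: "F \<le> min_at_top"
    and small: "\<And>c. c > 0 \<Longrightarrow>
      ((\<lambda>(x, y). \<P>(\<omega> in M. \<Theta> \<omega> > c * min x y) / scaled_tail x y) \<longlongrightarrow> 0) F"
    and a: "a1 \<ge> 0" "a2 \<ge> 0" "(a1, a2) \<noteq> (0, 0)"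
    and \<epsilon>: "0 < \<epsilon>" "\<epsilon> \<le> 1"
  shows "\<forall>\<^sub>F (x, y) in F. scaled_tail (x - a1) (y - a2) \<le> (1 + 5 * \<epsilon>) * scaled_tail x y"
proof -
  obtain \<delta> where \<delta>: "\<delta> > 0"
    "\<P>(\<omega> in M. 0 < \<Theta> \<omega> \<and> \<Theta> \<omega> \<le> \<delta>) \<le> \<epsilon> * \<P>(\<omega> in M. \<Theta> \<omega> > \<delta>)"
    using exists_scale_small_mass_below[OF measurable_\<Theta> not_zero \<epsilon>(1)] by auto
  have "\<forall>\<^sub>F (x, y) in min_at_top.
      joint_tail M X Y (x - a1 / \<delta>) (y - a2 / \<delta>) / joint_tail M X Y x y < 1 + \<epsilon>"
    using order_tendstoD(2)[OF base[of "a1 / \<delta>" "a2 / \<delta>"], of "1 + \<epsilon>"] a \<delta>(1) \<epsilon>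
    by (auto simp: case_prod_unfold)
  then obtain N0 where N0: "\<And>x y. x \<ge> N0 \<Longrightarrow> y \<ge> N0 \<Longrightarrow>
      joint_tail M X Y (x - a1 / \<delta>) (y - a2 / \<delta>) / joint_tail M X Y x y < 1 + \<epsilon>"
    by (auto simp: eventually_min_at_top)
  define N where "N = max N0 1"
  have N: "N > 0" by (simp add: N_def)
  have base_le: "joint_tail M X Y (u - a1 / \<delta>) (v - a2 / \<delta>) \<le> (1 + \<epsilon>) * joint_tail M X Y u v"
    if "u \<ge> N" "v \<ge> N" for u v
    using N0[of u v] pos[of u v] that N by (simp add: N_def pos_divide_less_eq)
  have "\<forall>\<^sub>F (x, y) in F. x \<ge> max a1 a2 \<and> y \<ge> max a1 a2"
    by (rule filter_leD[OF F]) (auto simp: eventually_min_at_top intro!: exI[of _ "max a1 a2"])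
  moreover have "\<forall>\<^sub>F (x, y) in F. \<P>(\<omega> in M. \<Theta> \<omega> > 1 / N * min x y) / scaled_tail x y < \<epsilon>"
    using order_tendstoD(2)[OF small[of "1 / N"] \<epsilon>(1)] N by (simp add: case_prod_unfold)
  ultimately show ?thesis
  proof eventually_elim
    case (elim z)
    obtain x y where z: "z = (x, y)" by force
    define S where "S \<omega> \<longleftrightarrow> \<Theta> \<omega> * X \<omega> > x - a1 \<and> \<Theta> \<omega> * Y \<omega> > y - a2" for \<omega>
    have [measurable]: "Measurable.pred M S" unfolding S_def by measurable
    have xy: "x \<ge> a1" "y \<ge> a2" "x \<ge> 0" "y \<ge> 0" using elim a by (auto simp: z)
    have large: "\<P>(\<omega> in M. \<Theta> \<omega> > min x y / N) \<le> \<epsilon> * scaled_tail x y"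
      using elim scaled_tail_pos[OF pos xy(3,4)] by (simp add: z pos_divide_less_eq)
    have "\<P>(\<omega> in M. (0 < \<Theta> \<omega> \<and> \<Theta> \<omega> \<le> \<delta>) \<and> S \<omega>)
        \<le> \<P>(\<omega> in M. 0 < \<Theta> \<omega> \<and> \<Theta> \<omega> \<le> \<delta>) * joint_tail M X Y ((x - a1) / \<delta>) ((y - a2) / \<delta>)"
      unfolding S_def using xy \<delta>(1) by (intro prob_small_scale_le) auto
    also have "\<dots> \<le> \<epsilon> * (\<P>(\<omega> in M. \<Theta> \<omega> > \<delta>) * joint_tail M X Y ((x - a1) / \<delta>) ((y - a2) / \<delta>))"
      unfolding mult.assoc[symmetric] using \<delta>(2)
      by (intro mult_right_mono) (auto simp: joint_tail_def)
    also have "\<dots> \<le> \<epsilon> * \<P>(\<omega> in M. \<Theta> \<omega> > \<delta> \<and> S \<omega>)"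
      unfolding S_def using xy \<delta>(1) \<epsilon> by (intro mult_left_mono prob_large_scale_ge) auto
    finally have low: "\<P>(\<omega> in M. (0 < \<Theta> \<omega> \<and> \<Theta> \<omega> \<le> \<delta>) \<and> S \<omega>) \<le> \<epsilon> * \<P>(\<omega> in M. \<Theta> \<omega> > \<delta> \<and> S \<omega>)" .
    have mid: "\<P>(\<omega> in M. (\<delta> < \<Theta> \<omega> \<and> \<Theta> \<omega> \<le> min x y / N) \<and> S \<omega>) \<le> (1 + \<epsilon>) * scaled_tail x y"
      unfolding S_def using \<delta>(1) N \<epsilon> a(1,2)
      by (intro moderate_scale_shift_bound base_le) auto
    have "\<P>(\<omega> in M. \<Theta> \<omega> > \<delta> \<and> S \<omega>)
        \<le> prob ({\<omega> \<in> space M. (\<delta> < \<Theta> \<omega> \<and> \<Theta> \<omega> \<le> min x y / N) \<and> S \<omega>}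
                \<union> {\<omega> \<in> space M. \<Theta> \<omega> > min x y / N})"
      by (intro finite_measure_mono) auto
    also have "\<dots> \<le> \<P>(\<omega> in M. (\<delta> < \<Theta> \<omega> \<and> \<Theta> \<omega> \<le> min x y / N) \<and> S \<omega>)
        + \<P>(\<omega> in M. \<Theta> \<omega> > min x y / N)"
      by (intro measure_Un_le) measurable
    also have "\<dots> \<le> (1 + 2 * \<epsilon>) * scaled_tail x y"
      using mid large by (simp add: algebra_simps)
    finally have high: "\<P>(\<omega> in M. \<Theta> \<omega> > \<delta> \<and> S \<omega>) \<le> (1 + 2 * \<epsilon>) * scaled_tail x y" .
    \<comment> \<open>Since \<open>x - a1 \<ge> 0\<close>, the event excludes \<open>\<Theta> = 0\<close>, so two ranges of \<open>\<Theta>\<close> exhaust it up to a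
      null set.\<close>
    have "scaled_tail (x - a1) (y - a2)
        \<le> prob ({\<omega> \<in> space M. (0 < \<Theta> \<omega> \<and> \<Theta> \<omega> \<le> \<delta>) \<and> S \<omega>} \<union> {\<omega> \<in> space M. \<Theta> \<omega> > \<delta> \<and> S \<omega>})"
      unfolding joint_tail_def
    proof (rule finite_measure_mono_AE)
      show "AE \<omega> in M. \<omega> \<in> {\<omega> \<in> space M. x - a1 < \<Theta> \<omega> * X \<omega> \<and> y - a2 < \<Theta> \<omega> * Y \<omega>} \<longrightarrow>
          \<omega> \<in> {\<omega> \<in> space M. (0 < \<Theta> \<omega> \<and> \<Theta> \<omega> \<le> \<delta>) \<and> S \<omega>} \<union> {\<omega> \<in> space M. \<Theta> \<omega> > \<delta> \<and> S \<omega>}"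
        using nonneg
      proof eventually_elim
        case (elim \<omega>)
        then show ?case using xy by (cases "\<Theta> \<omega> = 0") (auto simp: S_def)
      qed
    qed measurable
    also have "\<dots> \<le> \<P>(\<omega> in M. (0 < \<Theta> \<omega> \<and> \<Theta> \<omega> \<le> \<delta>) \<and> S \<omega>) + \<P>(\<omega> in M. \<Theta> \<omega> > \<delta> \<and> S \<omega>)"
      by (intro measure_Un_le) measurable
    also have "\<dots> \<le> (1 + \<epsilon>) * \<P>(\<omega> in M. \<Theta> \<omega> > \<delta> \<and> S \<omega>)"
      using low by (simp add: algebra_simps)
    also have "\<dots> \<le> (1 + \<epsilon>) * ((1 + 2 * \<epsilon>) * scaled_tail x y)"
      using high \<epsilon> by (intro mult_left_mono) auto
    also have "\<dots> \<le> (1 + 5 * \<epsilon>) * scaled_tail x y"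
    proof -
      have "\<epsilon> * \<epsilon> \<le> \<epsilon>" using \<epsilon> by (simp add: mult_left_le)
      then have "(1 + \<epsilon>) * (1 + 2 * \<epsilon>) \<le> 1 + 5 * \<epsilon>" by (simp add: algebra_simps)
      then show ?thesis
        unfolding mult.assoc[symmetric] by (rule mult_right_mono) (simp add: joint_tail_def)
    qed
    finally show ?case by (simp add: z)
  qed
qed

text \<open>Shifting down only enlarges the tail, so the ratio is at least \<open>1\<close> and the preceding bound
  suffices.\<close>

lemma scaled_tail_shift_ratio_tendsto:
  assumes pos: "\<And>x y. x \<ge> 0 \<Longrightarrow> y \<ge> 0 \<Longrightarrow> joint_tail M X Y x y > 0"
    and base: "\<And>b1 b2. b1 \<ge> 0 \<Longrightarrow> b2 \<ge> 0 \<Longrightarrow> (b1, b2) \<noteq> (0, 0) \<Longrightarrow>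
      ((\<lambda>(x, y). joint_tail M X Y (x - b1) (y - b2) / joint_tail M X Y x y) \<longlongrightarrow> 1) min_at_top"
    and F: "F \<le> min_at_top"
    and small: "\<And>c. c > 0 \<Longrightarrow>
      ((\<lambda>(x, y). \<P>(\<omega> in M. \<Theta> \<omega> > c * min x y) / scaled_tail x y) \<longlongrightarrow> 0) F"
    and a: "a1 \<ge> 0" "a2 \<ge> 0" "(a1, a2) \<noteq> (0, 0)"
  shows "((\<lambda>(x, y). scaled_tail (x - a1) (y - a2) / scaled_tail x y) \<longlongrightarrow> 1) F"
proof -
  have nonneg_xy: "\<forall>\<^sub>F (x, y) in F. x \<ge> 0 \<and> y \<ge> 0"
    by (rule filter_leD[OF F]) (auto simp: eventually_min_at_top intro!: exI[of _ 0])
  show ?thesis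
  proof (rule order_tendstoI)
    fix l :: real assume "l < 1"
    show "\<forall>\<^sub>F z in F. l < (case z of (x, y) \<Rightarrow> scaled_tail (x - a1) (y - a2) / scaled_tail x y)"
      using nonneg_xy
    proof eventually_elim
      case (elim z)
      obtain x y where z: "z = (x, y)" by force
      have "scaled_tail x y \<le> scaled_tail (x - a1) (y - a2)"
        using a by (intro joint_tail_antimono) auto
      moreover have "scaled_tail x y > 0" using elim by (intro scaled_tail_pos pos) (auto simp: z)
      ultimately have "1 \<le> scaled_tail (x - a1) (y - a2) / scaled_tail x y" by simp
      with \<open>l < 1\<close> show ?case by (simp add: z)
    qed
  next
    fix u :: real assume "1 < u"
    \<comment> \<open>Dividing by \<open>6\<close> rather than \<open>5\<close> keeps \<open>1 + 5 * \<epsilon>\<close> strictly below \<open>u\<close>.\<close>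
    define \<epsilon> where "\<epsilon> = min 1 ((u - 1) / 6)"
    have \<epsilon>: "0 < \<epsilon>" "\<epsilon> \<le> 1" "1 + 5 * \<epsilon> < u" using \<open>1 < u\<close> by (auto simp: \<epsilon>_def min_def field_simps)
    have "\<forall>\<^sub>F (x, y) in F. scaled_tail (x - a1) (y - a2) \<le> (1 + 5 * \<epsilon>) * scaled_tail x y"
      by (rule eventually_scaled_tail_shift_le) (fact pos base F small a \<epsilon>)+
    with nonneg_xy
    show "\<forall>\<^sub>F z in F. (case z of (x, y) \<Rightarrow> scaled_tail (x - a1) (y - a2) / scaled_tail x y) < u"
    proof eventually_elim
      case (elim z)
      obtain x y where z: "z = (x, y)" by force
      have "scaled_tail x y > 0" using elim by (intro scaled_tail_pos pos) (auto simp: z)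
      then have "scaled_tail (x - a1) (y - a2) / scaled_tail x y \<le> 1 + 5 * \<epsilon>"
        using elim by (simp add: z pos_divide_le_eq)
      with \<epsilon>(3) show ?case by (simp add: z)
    qed
  qed
qed

end

section \<open>Marginals as degenerate pairs\<close>

lemma (in prob_space) joint_tail_diagonal_eq_max:
  "joint_tail M X X x y = joint_tail M X X (max x y) (max x y)"
  by (auto simp: joint_tail_def intro!: arg_cong[where f = prob])

text \<open>The pair \<open>(X, X)\<close> inherits long-tailedness from \<open>X\<close>: its joint tail at \<open>(x, y)\<close> is the tail
  of \<open>X\<close> at \<open>max x y\<close>, and a shift by \<open>(b1, b2)\<close> lowers this maximum by at most
  \<open>max b1 b2\<close>.\<close>

lemma (in prob_space) diagonal_shift_ratio_tendsto:
  assumes X [measurable]: "X \<in> borel_measurable M"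
    and lt: "long_tailed (cdf (distr M borel X))"
    and b: "b1 \<ge> 0" "b2 \<ge> 0" "(b1, b2) \<noteq> (0, 0)"
  shows "((\<lambda>(x, y). joint_tail M X X (x - b1) (y - b2) / joint_tail M X X x y) \<longlongrightarrow> 1) min_at_top"
proof -
  define T where "T x = joint_tail M X X x x" for x
  define b where "b = max b1 b2"
  have JT: "joint_tail M X X x y = T (max x y)" for x y
    unfolding T_def by (rule joint_tail_diagonal_eq_max)
  have T_pos: "T x > 0" if "x \<ge> 0" for x
    using lt that by (simp add: long_tailed_def one_minus_cdf_eq_joint_tail T_def)
  have T_mono: "T y \<le> T x" if "x \<le> y" for x y
    unfolding T_def using that by (intro joint_tail_antimono) auto
  have "b > 0" using b by (auto simp: b_def)
  then have "((\<lambda>x. T (x - b) / T x) \<longlongrightarrow> 1) at_top"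
    using lt by (simp add: long_tailed_def one_minus_cdf_eq_joint_tail T_def)
  moreover have "filterlim (\<lambda>(x, y). max x y) at_top min_at_top"
    by (auto simp: filterlim_at_top eventually_min_at_top intro: max.coboundedI1)
  ultimately have upper: "((\<lambda>(x, y). T (max x y - b) / T (max x y)) \<longlongrightarrow> 1) min_at_top"
    by (auto dest: filterlim_compose simp: case_prod_unfold)
  have nonneg: "\<forall>\<^sub>F (x, y) in min_at_top. x \<ge> (0::real) \<and> y \<ge> (0::real)"
    by (auto simp: eventually_min_at_top intro!: exI[of _ 0])
  show ?thesis
  proof (rule tendsto_sandwich[OF _ _ tendsto_const upper])
    show "\<forall>\<^sub>F z in min_at_top. 1 \<le> (case z of (x, y) \<Rightarrow>
        joint_tail M X X (x - b1) (y - b2) / joint_tail M X X x y)"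
      using nonneg
    proof eventually_elim
      case (elim z)
      then show ?case using b unfolding JT by (auto simp: le_divide_eq T_pos le_max_iff_disj intro!: T_mono)
    qed
    show "\<forall>\<^sub>F z in min_at_top. (case z of (x, y) \<Rightarrow>
        joint_tail M X X (x - b1) (y - b2) / joint_tail M X X x y)
      \<le> (case z of (x, y) \<Rightarrow> T (max x y - b) / T (max x y))"
      using nonneg
    proof eventually_elim
      case (elim z)
      then show ?case unfolding JT
        by (auto intro!: divide_right_mono T_mono less_imp_le[OF T_pos] simp: b_def)
    qed
  qed
qed

text \<open>The univariate closure theorem is the bivariate one for \<open>(X, X)\<close>, read along the diagonal.\<close>

lemma long_tailed_scaled:
  assumes "independent_scaling M \<Theta> X X"
    and lt: "long_tailed (cdf (distr M borel X))"
    and small: "\<And>c. c > 0 \<Longrightarrow>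
      ((\<lambda>x. \<P>(\<omega> in M. \<Theta> \<omega> > c * x) / \<P>(\<omega> in M. \<Theta> \<omega> * X \<omega> > x)) \<longlongrightarrow> 0) at_top"
  shows "long_tailed (cdf (distr M borel (\<lambda>\<omega>. \<Theta> \<omega> * X \<omega>)))"
proof -
  interpret independent_scaling M \<Theta> X X by fact
  have pos: "joint_tail M X X x y > 0" if "x \<ge> 0" "y \<ge> 0" for x y
  proof -
    have "joint_tail M X X (max x y) (max x y) > 0"
      using lt that by (simp add: long_tailed_def one_minus_cdf_eq_joint_tail)
    then show ?thesis by (subst joint_tail_diagonal_eq_max)
  qed
  have "((\<lambda>x. scaled_tail (x - a) (x - a) / scaled_tail x x) \<longlongrightarrow> 1) at_top" if "a > 0" for a
  proof -
    have "((\<lambda>(x, y). scaled_tail (x - a) (y - a) / scaled_tail x y) \<longlongrightarrow> 1)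
        (filtermap (\<lambda>x. (x, x)) at_top)"
    proof (rule scaled_tail_shift_ratio_tendsto[OF pos _ filtermap_diagonal_le_min_at_top])
      show "((\<lambda>(x, y). \<P>(\<omega> in M. \<Theta> \<omega> > c * min x y) / scaled_tail x y) \<longlongrightarrow> 0)
          (filtermap (\<lambda>x. (x, x)) at_top)" if "c > 0" for c
        using small[OF that] by (simp add: filterlim_filtermap joint_tail_def)
    qed (use that diagonal_shift_ratio_tendsto[OF measurable_X lt] in auto)
    then show ?thesis by (simp add: filterlim_filtermap)
  qed
  then show ?thesis
    using scaled_tail_pos[OF pos] by (simp add: long_tailed_def one_minus_cdf_eq_joint_tail)
qed

section \<open>Closure of the bivariate class under scaling\<close>

theorem theorem5p2:
  fixes M :: "'a measure" and X Y \<Theta> :: "'a \<Rightarrow> real"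
  assumes "prob_space M"
    and "X \<in> borel_measurable M" and "Y \<in> borel_measurable M" and "\<Theta> \<in> borel_measurable M"
    and "AE \<omega> in M. \<Theta> \<omega> \<ge> 0"
    and "cdf (distr M borel \<Theta>) 0 < 1"
    and "indep_rvs M borel \<Theta> borel (\<lambda>\<omega>. (X \<omega>, Y \<omega>))"
    and "\<And>c. c > 0 \<Longrightarrow>
      ((\<lambda>(x, y). \<P>(\<omega> in M. \<Theta> \<omega> > c * min x y) /
                 joint_tail M (\<lambda>\<omega>. \<Theta> \<omega> * X \<omega>) (\<lambda>\<omega>. \<Theta> \<omega> * Y \<omega>) x y) \<longlongrightarrow> 0) min_at_top"
    and "long_tailed2 M X Y"
  shows "long_tailed2 M (\<lambda>\<omega>. \<Theta> \<omega> * X \<omega>) (\<lambda>\<omega>. \<Theta> \<omega> * Y \<omega>)"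
proof -
  let ?H = "joint_tail M (\<lambda>\<omega>. \<Theta> \<omega> * X \<omega>) (\<lambda>\<omega>. \<Theta> \<omega> * Y \<omega>)"
  note small = assms(8) and lt2 = assms(9)
  interpret independent_scaling M \<Theta> X Y
    using assms(1-7) by (simp add: independent_scaling_def independent_scaling_axioms_def)
  have pair: "(\<lambda>\<omega>. (X \<omega>, Y \<omega>)) \<in> borel_measurable M" by measurable
  have meas: "(\<lambda>p. (fst p, fst p)) \<in> borel_measurable (borel :: (real \<times> real) measure)"
    "(\<lambda>p. (snd p, snd p)) \<in> borel_measurable (borel :: (real \<times> real) measure)"
    by (auto intro!: borel_measurable_continuous_onI continuous_intros)
  have XX: "independent_scaling M \<Theta> X X"
    using assms(1-6) indep_rvs_compose[OF assms(1) pair indep meas(1)]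
    by (simp add: independent_scaling_def independent_scaling_axioms_def)
  have YY: "independent_scaling M \<Theta> Y Y"
    using assms(1-6) indep_rvs_compose[OF assms(1) pair indep meas(2)]
    by (simp add: independent_scaling_def independent_scaling_axioms_def)
  have pos: "joint_tail M X Y x y > 0" if "x \<ge> 0" "y \<ge> 0" for x y
    using lt2 that by (simp add: long_tailed2_def)
  \<comment> \<open>On the diagonal the joint tail is at most each marginal tail, so the hypothesis on \<open>\<Theta>\<close>
    passes to the marginals; \<open>W\<close> stands for \<open>\<Theta>X\<close> or \<open>\<Theta>Y\<close>.\<close>
  have marginal_small: "((\<lambda>x. \<P>(\<omega> in M. \<Theta> \<omega> > c * x) / \<P>(\<omega> in M. W \<omega> > x)) \<longlongrightarrow> 0) at_top"
    if "c > 0" and [measurable]: "W \<in> borel_measurable M"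
      and W: "\<And>x \<omega>. \<Theta> \<omega> * X \<omega> > x \<Longrightarrow> \<Theta> \<omega> * Y \<omega> > x \<Longrightarrow> W \<omega> > x" for c W
  proof (rule tendsto_sandwich[OF _ _ tendsto_const])
    show "((\<lambda>x. \<P>(\<omega> in M. \<Theta> \<omega> > c * x) / ?H x x) \<longlongrightarrow> 0) at_top"
      using tendsto_mono[OF filtermap_diagonal_le_min_at_top small[OF \<open>c > 0\<close>]]
      by (simp add: filterlim_filtermap)
    show "\<forall>\<^sub>F x in at_top. \<P>(\<omega> in M. \<Theta> \<omega> > c * x) / \<P>(\<omega> in M. W \<omega> > x)
        \<le> \<P>(\<omega> in M. \<Theta> \<omega> > c * x) / ?H x x"
      using eventually_ge_at_top[of 0]
    proof eventually_elim
      case (elim x)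
      have "?H x x \<le> \<P>(\<omega> in M. W \<omega> > x)"
        unfolding joint_tail_def using W by (intro finite_measure_mono) auto
      then show ?case
        using scaled_tail_pos[OF pos elim elim] by (intro divide_left_mono) auto
    qed
  qed auto
  have "long_tailed (cdf (distr M borel (\<lambda>\<omega>. \<Theta> \<omega> * X \<omega>)))"
    using lt2 by (intro long_tailed_scaled[OF XX] marginal_small) (auto simp: long_tailed2_def)
  moreover have "long_tailed (cdf (distr M borel (\<lambda>\<omega>. \<Theta> \<omega> * Y \<omega>)))"
    using lt2 by (intro long_tailed_scaled[OF YY] marginal_small) (auto simp: long_tailed2_def)
  moreover have "((\<lambda>(x, y). ?H (x - a1) (y - a2) / ?H x y) \<longlongrightarrow> 1) min_at_top"
    if "a1 \<ge> 0" "a2 \<ge> 0" "(a1, a2) \<noteq> (0, 0)" for a1 a2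
    by (rule scaled_tail_shift_ratio_tendsto[OF pos _ order_refl small that])
      (use lt2 in \<open>auto simp: long_tailed2_def\<close>)
  ultimately show ?thesis
    unfolding long_tailed2_def using scaled_tail_pos[OF pos] by auto
qed

end
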